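(* Let $\mathbb{D} \in \{\mathbb{R}, \mathbb{C}, \mathbb{H}\}$, let $n \geq 1$, and let $A, B \in \mathscr{P}_n(\mathbb{D})$. Assume that the Wasserstein mean $A \diamond B$ is linearizable, i.e. there exist $a, b \in \mathbb{R}$ such that $A \diamond B = aA + bB$. Then $|\mathrm{Spec}(A^{-1} \sharp B)| \leq 2$ and $AB = BA$.
   Context: For $\mathbb{D} \in \{\mathbb{R}, \mathbb{C}, \mathbb{H}\}$ (reals, complexes, quaternions), $\mathrm{Mat}_n(\mathbb{D})$ is the set of $n \times n$ matrices over $\mathbb{D}$, $X^* = \overline{X}^{t}$ is the conjugate transpose, and $\mathscr{P}_n(\mathbb{D})$ is the set of $X \in \mathrm{Mat}_n(\mathbb{D})$ with $X = X^*$ and $X > 0$ (positive definite). Every $X \in \mathscr{P}_n(\mathbb{D})$ can be written $X = U \,\mathrm{diag}(d_1, \ldots, d_n)\, U^*$ with $U U^* = \mathrm{Id}_n$ and real $d_i > 0$; the $d_i$ are the eigenvalues of $X$ (right eigenvalues when $\mathbb{D} = \mathbb{H}$), and $\mathrm{Spec}(X)$ is the set of eigenvalues, so $|\mathrm{Spec}(X)|$ is the number of distinct eigenvalues. Real powers of $X$ are defined by $X^t = U\,\mathrm{diag}(d_1^t, \ldots, d_n^t)\,U^*$. The geometric mean of $A, B \in \mathscr{P}_n(\mathbb{D})$ is $A \sharp B = A^{1/2}\left(A^{-1/2} B A^{-1/2}\right)^{1/2} A^{1/2}$; thus $A^{-1} \sharp B$ is the geometric mean of $A^{-1}$ and $B$.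 The Wasserstein mean of $A, B \in \mathscr{P}_n(\mathbb{D})$ is $$A \diamond B = \tfrac{1}{4}\left(\mathrm{Id}_n + A^{-1} \sharp B\right) A \left(\mathrm{Id}_n + A^{-1} \sharp B\right).$$ *)

theory Defs
  imports "HOL-Analysis.Analysis"
begin

datatype quat = Quat (qre: real) (qi: real) (qj: real) (qk: real)

lemma quat_eq_iff:
  "x = y \<longleftrightarrow> qre x = qre y \<and> qi x = qi y \<and> qj x = qj y \<and> qk x = qk y"
  by (cases x; cases y) simp

instantiation quat :: ring_1
begin

definition "0 = Quat 0 0 0 0"
definition "1 = Quat 1 0 0 0"
definition "x + y = Quat (qre x + qre y) (qi x + qi y) (qj x + qj y) (qk x + qk y)"
definition "- x = Quat (- qre x) (- qi x) (- qj x) (- qk x)"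
definition "x - y = Quat (qre x - qre y) (qi x - qi y) (qj x - qj y) (qk x - qk y)"
definition "x * y = Quat
  (qre x * qre y - qi x * qi y - qj x * qj y - qk x * qk y)
  (qre x * qi y + qi x * qre y + qj x * qk y - qk x * qj y)
  (qre x * qj y - qi x * qk y + qj x * qre y + qk x * qi y)
  (qre x * qk y + qi x * qj y - qj x * qi y + qk x * qre y)"

instance
  by standard
    (simp_all add: zero_quat_def one_quat_def plus_quat_def uminus_quat_def minus_quat_def
      times_quat_def algebra_simps)

end

lemma quat_zero_sel [simp]: "qre 0 = 0" "qi 0 = 0" "qj 0 = 0" "qk 0 = 0"
  by (simp_all add: zero_quat_def)

lemma quat_one_sel [simp]: "qre 1 = 1" "qi 1 = 0" "qj 1 = 0" "qk 1 = 0"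
  by (simp_all add: one_quat_def)

lemma quat_add_sel [simp]:
  "qre (x + y) = qre x + qre y" "qi (x + y) = qi x + qi y"
  "qj (x + y) = qj x + qj y" "qk (x + y) = qk x + qk y"
  by (simp_all add: plus_quat_def)

lemma quat_uminus_sel [simp]:
  "qre (- x) = - qre x" "qi (- x) = - qi x" "qj (- x) = - qj x" "qk (- x) = - qk x"
  by (simp_all add: uminus_quat_def)

lemma quat_diff_sel [simp]:
  "qre (x - y) = qre x - qre y" "qi (x - y) = qi x - qi y"
  "qj (x - y) = qj x - qj y" "qk (x - y) = qk x - qk y"
  by (simp_all add: minus_quat_def)

lemma quat_mult_sel [simp]:
  "qre (x * y) = qre x * qre y - qi x * qi y - qj x * qj y - qk x * qk y"
  "qi (x * y) = qre x * qi y + qi x * qre y + qj x * qk y - qk x * qj y"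
  "qj (x * y) = qre x * qj y - qi x * qk y + qj x * qre y + qk x * qi y"
  "qk (x * y) = qre x * qk y + qi x * qj y - qj x * qi y + qk x * qre y"
  by (simp_all add: times_quat_def)

lemma quat_sum_squares_eq_0_iff:
  "(qre x)\<^sup>2 + (qi x)\<^sup>2 + (qj x)\<^sup>2 + (qk x)\<^sup>2 = 0 \<longleftrightarrow> x = 0"
  by (simp add: quat_eq_iff add_nonneg_eq_0_iff)

instantiation quat :: inverse
begin

definition "inverse x =
  (let s = (qre x)\<^sup>2 + (qi x)\<^sup>2 + (qj x)\<^sup>2 + (qk x)\<^sup>2
   in Quat (qre x / s) (- qi x / s) (- qj x / s) (- qk x / s))"

definition "x div y = x * inverse (y :: quat)"

instance ..

end

instantiation quat :: real_div_algebra
begin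

definition "r *\<^sub>R x = Quat (r * qre x) (r * qi x) (r * qj x) (r * qk x)"

instance
proof
  fix x y :: quat and a b :: real
  show "a *\<^sub>R (x + y) = a *\<^sub>R x + a *\<^sub>R y" "(a + b) *\<^sub>R x = a *\<^sub>R x + b *\<^sub>R x"
    "a *\<^sub>R b *\<^sub>R x = (a * b) *\<^sub>R x" "1 *\<^sub>R x = x"
    "a *\<^sub>R x * y = a *\<^sub>R (x * y)" "x * a *\<^sub>R y = a *\<^sub>R (x * y)"
    by (simp_all add: quat_eq_iff scaleR_quat_def algebra_simps)
  show "x / y = x * inverse y" by (fact divide_quat_def)
  show "inverse (0 :: quat) = 0" by (simp add: inverse_quat_def quat_eq_iff)
  define s where "s = (qre x)\<^sup>2 + (qi x)\<^sup>2 + (qj x)\<^sup>2 + (qk x)\<^sup>2"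
  define c where "c = 1 / s"
  have inv: "inverse x = c *\<^sub>R Quat (qre x) (- qi x) (- qj x) (- qk x)"
    by (simp add: inverse_quat_def s_def c_def Let_def scaleR_quat_def)
  assume "x \<noteq> 0"
  then have "s \<noteq> 0" by (simp add: s_def quat_sum_squares_eq_0_iff)
  then have "c * s = 1" by (simp add: c_def)
  then show "inverse x * x = 1" "x * inverse x = 1"
    unfolding inv s_def
    by (simp_all add: quat_eq_iff scaleR_quat_def power2_eq_square algebra_simps)
qed

end

text \<open>Only a common interface to \<open>\<real>\<close>, \<open>\<complex>\<close> and the quaternions; results are stated for these three
  instances.\<close>

class star_div_algebra = real_div_algebra +
  fixes star_conj :: "'a \<Rightarrow> 'a"
  assumes star_conj_add: "star_conj (x + y) = star_conj x + star_conj y"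
    and star_conj_mult: "star_conj (x * y) = star_conj y * star_conj x"
    and star_conj_star_conj: "star_conj (star_conj x) = x"
    and star_conj_scaleR: "star_conj (r *\<^sub>R x) = r *\<^sub>R star_conj x"

instantiation real :: star_div_algebra
begin

definition "star_conj (x :: real) = x"

instance by standard (simp_all add: star_conj_real_def)

end

instantiation complex :: star_div_algebra
begin

definition "star_conj (x :: complex) = cnj x"

instance by standard (simp_all add: star_conj_complex_def)

end

instantiation quat :: star_div_algebra
begin

definition "star_conj x = Quat (qre x) (- qi x) (- qj x) (- qk x)"

instance
  by standard (simp_all add: star_conj_quat_def quat_eq_iff scaleR_quat_def algebra_simps)

end

definition conj_transpose :: "'d::star_div_algebra^'n^'n \<Rightarrow> 'd^'n^'n" where
  "conj_transpose X = (\<chi> i j. star_conj (X $ j $ i))"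

text \<open>Positivity of \<open>v\<^sup>* X v\<close> says that this scalar of the division algebra is
  a positive real number.\<close>

definition pos_def :: "('d::star_div_algebra^'n^'n) set" where
  "pos_def = {X. X = conj_transpose X \<and>
    (\<forall>v. v \<noteq> 0 \<longrightarrow> (\<exists>r>0. (\<Sum>i\<in>UNIV. star_conj (v $ i) * (X *v v) $ i) = of_real r))}"

definition real_diag :: "('n \<Rightarrow> real) \<Rightarrow> 'd::star_div_algebra^'n^'n" where
  "real_diag d = (\<chi> i j. if i = j then of_real (d i) else 0)"

text \<open>Only meaningful for \<open>X \<in> pos_def\<close>, where a spectral decomposition exists and
  the resulting power does not depend on its choice.\<close>

definition mat_powr :: "'d::star_div_algebra^'n^'n \<Rightarrow> real \<Rightarrow> 'd^'n^'n" where
  "mat_powr X t = (THE Y. \<exists>U d. U ** conj_transpose U = mat 1 \<and> (\<forall>i. d i > 0) \<and>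
     X = U ** real_diag d ** conj_transpose U \<and>
     Y = U ** real_diag (\<lambda>i. d i powr t) ** conj_transpose U)"

text \<open>Right eigenvalues; over a commutative \<open>'d\<close> these are the usual eigenvalues.\<close>

definition Spec :: "'d::star_div_algebra^'n^'n \<Rightarrow> 'd set" where
  "Spec X = {l. \<exists>v. v \<noteq> 0 \<and> X *v v = (\<chi> i. v $ i * l)}"

definition geometric_mean ::
    "'d::star_div_algebra^'n^'n \<Rightarrow> 'd^'n^'n \<Rightarrow> 'd^'n^'n" (infixl "\<sharp>" 75) where
  "A \<sharp> B = mat_powr A (1/2) **
     mat_powr (mat_powr A (-1/2) ** B ** mat_powr A (-1/2)) (1/2) ** mat_powr A (1/2)"

definition wasserstein_mean ::
    "'d::star_div_algebra^'n^'n \<Rightarrow> 'd^'n^'n \<Rightarrow> 'd^'n^'n" (infixl "\<diamondop>" 75) where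
  "A \<diamondop> B = (1/4) *\<^sub>R
     ((mat 1 + matrix_inv A \<sharp> B) ** A ** (mat 1 + matrix_inv A \<sharp> B))"

definition wasserstein_linearizable ::
    "'d::star_div_algebra^'n^'n \<Rightarrow> 'd^'n^'n \<Rightarrow> bool" where
  "wasserstein_linearizable A B \<longleftrightarrow> (\<exists>a b :: real. A \<diamondop> B = a *\<^sub>R A + b *\<^sub>R B)"

end

theory Submission
  imports Defs
begin

text \<open>Put \<open>H = A\<^sup>-\<^sup>1 \<sharp> B\<close>. This matrix is positive definite and solves the Riccati equation \<open>H A H = B\<close>
  (\<open>geometric_mean_riccati\<close>), so \<open>4 (A \<diamondop> B) = A + H A + A H + B\<close>, and linearizability becomes
  \<open>H A + A H = p A + q H A H\<close> with real \<open>p\<close> and \<open>q\<close>. In an orthonormal eigenbasis of \<open>H\<close>, with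
  eigenvalues \<open>h\<^sub>i\<close> and \<open>N\<close> the matrix of \<open>A\<close>, this reads
  \<open>(h\<^sub>i + h\<^sub>j) N\<^sub>i\<^sub>j = (p + q h\<^sub>i h\<^sub>j) N\<^sub>i\<^sub>j\<close>.
  Since \<open>N\<close> is positive definite, its diagonal entries do not vanish, and every \<open>h\<^sub>i\<close> is a root of
  the nonzero polynomial \<open>q x\<^sup>2 - 2 x + p\<close>; hence \<open>H\<close> has at most two eigenvalues. Where
  \<open>N\<^sub>i\<^sub>j \<noteq> 0\<close> the same relation holds with \<open>h\<^sub>i\<close> and \<open>h\<^sub>j\<close> mixed, and combined with the two quadratic
  equations it forces \<open>h\<^sub>i = h\<^sub>j\<close> (\<open>quadratic_roots_eq_if_polarized\<close>). So \<open>N\<close> commutes with the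
  diagonal matrix of the \<open>h\<^sub>i\<close>, that is, \<open>A\<close> commutes with \<open>H\<close> and with \<open>B = H A H\<close>.

  The argument is the same over the reals, the complex numbers and the quaternions. What they share
  is a Euclidean inner product that is the real part of \<open>x\<^sup>* y\<close>; the class
  \<open>hermitian_div_algebra\<close> records this. It makes matrices act on a real Euclidean space with
  the conjugate transpose as the adjoint operator, which gives the spectral theorem over all three
  algebras at once, without commutativity (\<open>spectral_decomposition\<close>). Independence of real powers from
  the chosen decomposition (\<open>spectral_calculus_unique\<close>) then turns \<open>mat_powr\<close> into a usable
  functional calculus.\<close>

section \<open>The three algebras as Euclidean spaces\<close>

instantiation quat :: euclidean_space
begin

definition inner_quat_def:
  "inner x y = qre x * qre y + qi x * qi y + qj x * qj y + qk x * qk y"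

definition norm_quat_def: "norm (x :: quat) = sqrt (inner x x)"

definition sgn_quat_def: "sgn (x :: quat) = x /\<^sub>R norm x"

definition dist_quat_def: "dist (x :: quat) y = norm (x - y)"

definition uniformity_quat_def:
  "(uniformity :: (quat \<times> quat) filter) = (INF e\<in>{0 <..}. principal {(x, y). dist x y < e})"

definition open_quat_def:
  "open (U :: quat set) \<longleftrightarrow> (\<forall>x\<in>U. eventually (\<lambda>(x', y). x' = x \<longrightarrow> y \<in> U) uniformity)"

definition Basis_quat_def:
  "Basis = {Quat 1 0 0 0, Quat 0 1 0 0, Quat 0 0 1 0, Quat 0 0 0 1}"

lemma inner_Basis_quat:
  fixes u v :: quat
  assumes "u \<in> Basis" "v \<in> Basis"
  shows "inner u v = (if u = v then 1 else 0)"
  using assms unfolding Basis_quat_def by (elim insertE emptyE) (simp_all add: inner_quat_def)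

lemma inner_Basis_quat_zero_iff:
  fixes x :: quat
  shows "(\<forall>u\<in>Basis. inner x u = 0) \<longleftrightarrow> x = 0"
  by (simp add: Basis_quat_def inner_quat_def) (simp add: quat_eq_iff[of x])

instance
proof
  fix x y z :: quat and r :: real and U :: "quat set"
  show "inner x y = inner y x"
    by (simp add: inner_quat_def mult.commute)
  show "inner (x + y) z = inner x z + inner y z"
    unfolding inner_quat_def quat_add_sel distrib_right by (simp only: ac_simps)
  show "inner (r *\<^sub>R x) y = r * inner x y"
    by (simp add: inner_quat_def scaleR_quat_def distrib_left)
  show "0 \<le> inner x x"
    by (simp add: inner_quat_def)
  show "inner x x = 0 \<longleftrightarrow> x = 0"
    using quat_sum_squares_eq_0_iff[of x] by (simp add: inner_quat_def power2_eq_square)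
  show "dist x y = norm (x - y)" "sgn x = x /\<^sub>R norm x" "norm x = sqrt (inner x x)"
    by (simp_all add: dist_quat_def sgn_quat_def norm_quat_def)
  show "(uniformity :: (quat \<times> quat) filter) = (INF e\<in>{0 <..}. principal {(x, y). dist x y < e})"
    by (fact uniformity_quat_def)
  show "open U \<longleftrightarrow> (\<forall>x\<in>U. eventually (\<lambda>(x', y). x' = x \<longrightarrow> y \<in> U) uniformity)"
    by (fact open_quat_def)
  show "(Basis :: quat set) \<noteq> {}" "finite (Basis :: quat set)"
    by (simp_all add: Basis_quat_def)
  show "inner u v = (if u = v then 1 else 0)" if "u \<in> Basis" "v \<in> Basis" for u v :: quat
    using that by (rule inner_Basis_quat)
  show "(\<forall>u\<in>Basis. inner x u = 0) \<longleftrightarrow> x = 0"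
    by (rule inner_Basis_quat_zero_iff)
qed

end

text \<open>The axiom says that the inner product is the real part of \<open>x\<^sup>* y\<close>. In particular, elements fixed
  by the conjugation are real multiples of 1, and \<open>x\<^sup>* x\<close> is the squared norm of \<open>x\<close>.\<close>

class hermitian_div_algebra = star_div_algebra + euclidean_space +
  assumes scaleR_inner_one: "(2 * inner x y) *\<^sub>R 1 = star_conj x * y + star_conj y * x"

lemma of_real_inner:
  fixes x y :: "'d::hermitian_div_algebra"
  shows "of_real (2 * inner x y) = star_conj x * y + star_conj y * x"
  unfolding of_real_def by (rule scaleR_inner_one)

instance real :: hermitian_div_algebra
  by standard (simp add: star_conj_real_def)

instance complex :: hermitian_div_algebra
  by standard (simp add: star_conj_complex_def inner_complex_def complex_eq_iff algebra_simps)

instance quat :: hermitian_div_algebra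
  by standard
    (simp add: star_conj_quat_def inner_quat_def scaleR_quat_def quat_eq_iff algebra_simps)

lemma star_conj_0 [simp]: "star_conj 0 = 0"
  using star_conj_add[of 0 0] by simp

lemma star_conj_1 [simp]: "star_conj 1 = 1"
  by (metis mult.right_neutral star_conj_mult star_conj_star_conj)

lemma star_conj_of_real [simp]: "star_conj (of_real r) = of_real r"
  by (simp add: of_real_def star_conj_scaleR)

lemma star_conj_sum: "star_conj (sum f S) = (\<Sum>i\<in>S. star_conj (f i))"
  by (induction S rule: infinite_finite_induct) (simp_all add: star_conj_add)

section \<open>Hermitian products and adjoints\<close>

text \<open>Vectors carry the scalars on the right. Left multiplication by a matrix commutes with them and
  has the conjugate transpose as its adjoint for this product, also over the quaternions.\<close>

definition herm_prod :: "'d::star_div_algebra^'n \<Rightarrow> 'd^'n \<Rightarrow> 'd" where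
  "herm_prod u v = (\<Sum>i\<in>UNIV. star_conj (u $ i) * v $ i)"

lemma herm_prod_add_right: "herm_prod u (v + w) = herm_prod u v + herm_prod u w"
  by (simp add: herm_prod_def distrib_left sum.distrib)

lemma herm_prod_scaleR_right: "herm_prod u (r *\<^sub>R v) = r *\<^sub>R herm_prod u v"
  by (simp add: herm_prod_def scaleR_sum_right)

lemma herm_prod_commute: "star_conj (herm_prod u v) = herm_prod v u"
  by (simp add: herm_prod_def star_conj_sum star_conj_mult star_conj_star_conj)

lemma of_real_inner_vec:
  fixes u v :: "'d::hermitian_div_algebra^'n"
  shows "of_real (2 * inner u v) = herm_prod u v + herm_prod v u"
  by (simp only: inner_vec_def herm_prod_def sum_distrib_left of_real_sum of_real_inner sum.distrib)

lemma herm_prod_self: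
  fixes u :: "'d::hermitian_div_algebra^'n"
  shows "herm_prod u u = of_real (inner u u)"
proof -
  have "2 *\<^sub>R herm_prod u u = 2 *\<^sub>R of_real (inner u u)"
    using of_real_inner_vec[of u u] by (simp only: mult_2 of_real_add scaleR_2)
  then show ?thesis by simp
qed

lemma conj_transpose_conj_transpose [simp]: "conj_transpose (conj_transpose X) = X"
  by (simp add: conj_transpose_def vec_eq_iff star_conj_star_conj)

lemma conj_transpose_mult: "conj_transpose (X ** Y) = conj_transpose Y ** conj_transpose X"
  by (simp add: conj_transpose_def matrix_matrix_mult_def vec_eq_iff star_conj_sum star_conj_mult)

lemma herm_prod_adjoint: "herm_prod (conj_transpose M *v u) v = herm_prod u (M *v v)"
proof -
  have "herm_prod (conj_transpose M *v u) v
      = (\<Sum>i\<in>UNIV. \<Sum>j\<in>UNIV. star_conj (u $ j) * M $ j $ i * v $ i)"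
    by (simp add: herm_prod_def matrix_vector_mult_def conj_transpose_def star_conj_sum
        star_conj_mult star_conj_star_conj sum_distrib_right)
  also have "\<dots> = (\<Sum>j\<in>UNIV. \<Sum>i\<in>UNIV. star_conj (u $ j) * M $ j $ i * v $ i)"
    by (rule sum.swap)
  also have "\<dots> = herm_prod u (M *v v)"
    by (simp add: herm_prod_def matrix_vector_mult_def sum_distrib_left mult.assoc)
  finally show ?thesis .
qed

text \<open>The real inner product is the symmetrization of the hermitian one, so it inherits the
  adjoint. A matrix equal to its conjugate transpose is therefore a self-adjoint real operator.\<close>

lemma inner_adjoint:
  fixes u v :: "'d::hermitian_div_algebra^'n"
  shows "inner u (M *v v) = inner (conj_transpose M *v u) v"
proof -
  have "herm_prod (M *v v) u = herm_prod v (conj_transpose M *v u)"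
    using herm_prod_adjoint[of "conj_transpose M" v u] by simp
  then have "(of_real (2 * inner u (M *v v)) :: 'd) = of_real (2 * inner (conj_transpose M *v u) v)"
    unfolding of_real_inner_vec by (simp add: herm_prod_adjoint)
  then show ?thesis by (simp only: of_real_eq_iff)
qed

section \<open>The spectral theorem\<close>

text \<open>A maximum of the quadratic form on the unit sphere of the subspace exists by compactness; the
  first-order condition there says that \<open>f u - c u\<close> is orthogonal to the subspace. As it also belongs to
  the subspace, it vanishes.\<close>

lemma self_adjoint_eigenvector_in_subspace:
  fixes f :: "'e::euclidean_space \<Rightarrow> 'e"
  assumes lin: "linear f" and sym: "\<And>x y. inner x (f y) = inner (f x) y"
    and W: "subspace W" "f ` W \<subseteq> W" "W \<noteq> {0}"
  obtains u c where "u \<in> W" "norm u = 1" "f u = c *\<^sub>R u"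
proof -
  let ?K = "sphere 0 1 \<inter> W"
  have 0: "0 \<in> W" using W(1) by (rule subspace_0)
  then obtain w where w: "w \<in> W" "w \<noteq> 0" using W(3) by blast
  have "w /\<^sub>R norm w \<in> ?K"
    using w W(1) by (simp add: subspace_scale)
  then have ne: "?K \<noteq> {}" by blast
  have comp: "compact ?K"
    using closed_subspace[OF W(1)] by (intro compact_Int_closed) simp_all
  have cont: "continuous_on ?K (\<lambda>v. inner v (f v))"
    using lin by (intro continuous_intros linear_continuous_on linear_conv_bounded_linear[THEN iffD1])
  obtain u where u: "u \<in> ?K" and max: "\<And>v. v \<in> ?K \<Longrightarrow> inner v (f v) \<le> inner u (f u)"
    using continuous_attains_sup[OF comp ne cont] by blast
  define c where "c = inner u (f u)"
  have bound: "inner v (f v) \<le> c * inner v v" if "v \<in> W" for v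
  proof (cases "v = 0")
    case False
    then have "v /\<^sub>R norm v \<in> ?K" using that W(1) by (simp add: subspace_scale)
    then have "inner (v /\<^sub>R norm v) (f (v /\<^sub>R norm v)) \<le> c" unfolding c_def by (rule max)
    then have "inner v (f v) / (norm v * norm v) \<le> c"
      by (simp add: linear_scale[OF lin] divide_inverse mult_ac)
    then show ?thesis
      using False by (simp add: divide_le_eq power2_norm_eq_inner[symmetric] power2_eq_square)
  qed simp
  define w where "w = f u - c *\<^sub>R u"
  define k where "k = inner w (f w) - c * inner w w"
  have uW: "u \<in> W" and nu: "norm u = 1" using u by auto
  have uu: "inner u u = 1" using nu by (simp add: norm_eq_1)
  have wW: "w \<in> W"
    unfolding w_def using uW W by (intro subspace_diff subspace_scale) auto
  \<comment> \<open>Maximality at \<open>u\<close> makes this quadratic polynomial in \<open>t\<close> nonpositive, so its linear coefficient,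
    twice the squared norm of \<open>w\<close>, vanishes.\<close>
  have quad: "2 * t * inner w w + t\<^sup>2 * k \<le> 0" for t :: real
  proof -
    have "u + t *\<^sub>R w \<in> W" using uW wW W(1) by (simp add: subspace_add subspace_scale)
    from bound[OF this]
    have "inner u (f u) + t * inner u (f w) + t * inner w (f u) + t\<^sup>2 * inner w (f w)
        \<le> c * (inner u u + 2 * t * inner w u + t\<^sup>2 * inner w w)"
      by (simp add: linear_add[OF lin] linear_scale[OF lin] inner_add_left inner_add_right
          algebra_simps power2_eq_square inner_commute)
    moreover have "inner u (f w) = inner w (f u)"
      using sym[of u w] by (simp add: inner_commute)
    moreover have "inner w (f u) = inner w w + c * inner w u"
      by (simp add: w_def inner_diff_right)
    ultimately show ?thesis
      by (simp add: k_def c_def[symmetric] uu algebra_simps)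
  qed
  have "inner w w = 0"
  proof (rule ccontr)
    assume "inner w w \<noteq> 0"
    then have pos: "inner w w > 0" using inner_ge_zero[of w] by linarith
    \<comment> \<open>Small enough for the linear term to dominate the quadratic one.\<close>
    define t where "t = inner w w / (\<bar>k\<bar> + 1)"
    have t: "t > 0" using pos by (simp add: t_def add_nonneg_pos)
    have "t * (2 * inner w w + t * k) \<le> 0"
      using quad[of t] by (simp add: algebra_simps power2_eq_square)
    then have "2 * inner w w + t * k \<le> 0" using t by (simp add: mult_le_0_iff)
    moreover have "t * \<bar>k\<bar> \<le> t * (\<bar>k\<bar> + 1)" using t by simp
    moreover have "t * (\<bar>k\<bar> + 1) = inner w w" by (simp add: t_def)
    moreover have "- (t * \<bar>k\<bar>) \<le> t * k" using mult_left_mono[of "- \<bar>k\<bar>" k t] t by simp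
    ultimately show False using pos by linarith
  qed
  then have "f u = c *\<^sub>R u" by (simp add: w_def)
  with uW nu show thesis by (rule that)
qed

text \<open>A noncommutative algebra has no determinant in the usual sense; counting real dimensions takes
  its place: an injective real linear endomorphism is surjective.\<close>

lemma matrix_left_right_inverse_herm:
  fixes A B :: "'d::hermitian_div_algebra^'n^'n"
  assumes "A ** B = mat 1"
  shows "B ** A = mat 1"
proof -
  have id: "A *v (B *v x) = x" for x by (simp add: matrix_vector_mul_assoc assms)
  have "inj ((*v) B)" by (rule inj_on_inverseI[where g = "(*v) A"]) (rule id)
  then have "surj ((*v) B)"
    by (rule linear_inj_imp_surj[OF matrix_vector_mul_linear])
  then have "B *v (A *v x) = x" for x
    using id by (auto dest!: surjD[of _ x])
  then show ?thesis by (simp add: matrix_eq matrix_vector_mul_assoc)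
qed

text \<open>The products with the \<open>u i\<close>, padded by zeros outside \<open>S\<close>, form a real linear endomorphism. It misses
  every nonzero vector supported on an index outside \<open>S\<close>, so by real dimension it has a kernel.\<close>

lemma orthogonal_complement_nontrivial:
  fixes u :: "'n::finite \<Rightarrow> 'd::hermitian_div_algebra^'n"
  assumes "S \<noteq> UNIV"
  shows "{v. \<forall>i\<in>S. herm_prod (u i) v = 0} \<noteq> {0}"
proof -
  define f where "f v = (\<chi> i. if i \<in> S then herm_prod (u i) v else 0)" for v
  have lin: "linear f"
    by (rule linearI)
      (simp_all add: f_def vec_eq_iff herm_prod_add_right herm_prod_scaleR_right)
  obtain k where "k \<notin> S" using assms by blast
  then have "f v $ k = 0" for v by (simp add: f_def)
  then have "f v \<noteq> axis k 1" for v by (metis axis_nth zero_neq_one)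
  then have "\<not> surj f" unfolding surj_def by metis
  then have "\<not> inj f" using linear_inj_imp_surj[OF lin] by blast
  then obtain v where v: "v \<noteq> 0" "f v = 0" using linear_injective_0[OF lin] by blast
  have "herm_prod (u i) v = 0" if "i \<in> S" for i
  proof -
    have "f v $ i = herm_prod (u i) v" using that by (simp add: f_def)
    then show ?thesis using v(2) by simp
  qed
  with v(1) show ?thesis by blast
qed

text \<open>By induction on the index set: the complement of the eigenvectors found so far is a
  nonzero real subspace invariant under \<open>X\<close>, so it contains a unit eigenvector. Orthogonality is
  meant for \<open>herm_prod\<close>, not only for the real inner product, which is why the columns obtained are
  unitary over the algebra.\<close>

lemma orthonormal_eigenvectors:
  fixes X :: "'d::hermitian_div_algebra^'n^'n" and S :: "'n set"
  assumes X: "X = conj_transpose X"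
  shows "\<exists>u d. (\<forall>i\<in>S. X *v u i = d i *\<^sub>R u i) \<and>
    (\<forall>i\<in>S. \<forall>j\<in>S. herm_prod (u i) (u j) = (if i = j then 1 else 0))"
  using finite[of S]
proof (induction S rule: finite_induct)
  case empty
  show ?case by simp
next
  case (insert k S)
  then obtain u d where eig: "\<And>i. i \<in> S \<Longrightarrow> X *v u i = d i *\<^sub>R u i"
    and orth: "\<And>i j. i \<in> S \<Longrightarrow> j \<in> S \<Longrightarrow> herm_prod (u i) (u j) = (if i = j then 1 else 0)"
    by blast
  let ?W = "{v. \<forall>i\<in>S. herm_prod (u i) v = 0}"
  have sub: "subspace ?W"
    by (auto simp: subspace_def herm_prod_add_right herm_prod_scaleR_right)
      (simp add: herm_prod_def)
  have inv: "(*v) X ` ?W \<subseteq> ?W"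
  proof (clarify)
    fix v i assume v: "\<forall>i\<in>S. herm_prod (u i) v = 0" and i: "i \<in> S"
    have "herm_prod (u i) (X *v v) = herm_prod (d i *\<^sub>R u i) v"
      using herm_prod_adjoint[of X "u i" v] X eig[OF i] by simp
    also have "\<dots> = star_conj (d i *\<^sub>R herm_prod v (u i))"
      by (metis herm_prod_commute herm_prod_scaleR_right)
    also have "\<dots> = 0"
      using v i by (simp add: star_conj_scaleR herm_prod_commute)
    finally show "herm_prod (u i) (X *v v) = 0" .
  qed
  have "S \<noteq> UNIV" using insert.hyps(2) by blast
  then have "?W \<noteq> {0}" by (rule orthogonal_complement_nontrivial)
  then obtain x c where x: "x \<in> ?W" "norm x = 1" "X *v x = c *\<^sub>R x"
    using self_adjoint_eigenvector_in_subspace[of "(*v) X" ?W] sub inv inner_adjoint[of _ X] X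
    by (metis (no_types, lifting) matrix_vector_mul_linear)
  have xx: "herm_prod x x = 1"
    using x(2) by (simp add: herm_prod_self norm_eq_1)
  have ux: "herm_prod (u i) x = 0" "herm_prod x (u i) = 0" if "i \<in> S" for i
    using x(1) that herm_prod_commute[of "u i" x] by auto
  show ?case
    by (rule exI[of _ "u(k := x)"], rule exI[of _ "d(k := c)"])
      (use insert.hyps(2) in \<open>auto simp: eig orth x(3) xx ux\<close>)
qed

lemma real_diag_mult_component: "(real_diag d ** M) $ i $ j = d i *\<^sub>R M $ i $ j"
  by (simp add: matrix_matrix_mult_def real_diag_def if_distrib[of "\<lambda>x. x * _"]
      scaleR_conv_of_real cong: if_cong)

lemma mult_real_diag_component: "(M ** real_diag d) $ i $ j = d j *\<^sub>R M $ i $ j"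
  by (simp add: matrix_matrix_mult_def real_diag_def if_distrib[of "(*) _"]
      of_real_def cong: if_cong)

lemma conj_transpose_real_diag [simp]: "conj_transpose (real_diag d) = real_diag d"
  by (simp add: conj_transpose_def real_diag_def vec_eq_iff)

lemma real_diag_mult: "real_diag d ** real_diag e = real_diag (\<lambda>i. d i * e i)"
  by (simp add: vec_eq_iff real_diag_mult_component)
    (simp add: real_diag_def scaleR_conv_of_real)

lemma real_diag_one: "real_diag (\<lambda>i. 1) = mat 1"
  by (simp add: real_diag_def mat_def vec_eq_iff)

lemma real_diag_vector: "(real_diag d *v v) $ i = d i *\<^sub>R v $ i"
  by (simp add: matrix_vector_mult_def real_diag_def if_distrib[of "\<lambda>x. x * _"]
      scaleR_conv_of_real cong: if_cong)

theorem spectral_decomposition: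
  fixes X :: "'d::hermitian_div_algebra^'n^'n"
  assumes "X = conj_transpose X"
  obtains U d where "U ** conj_transpose U = mat 1" "X = U ** real_diag d ** conj_transpose U"
proof -
  obtain u :: "'n \<Rightarrow> 'd^'n" and d where eig: "\<And>i. X *v u i = d i *\<^sub>R u i"
    and orth: "\<And>i j. herm_prod (u i) (u j) = (if i = j then 1 else 0)"
    using orthonormal_eigenvectors[OF assms, of UNIV] by auto
  define U where "U = (\<chi> i j. u j $ i)"
  have "conj_transpose U ** U = mat 1"
    using orth
    by (simp add: U_def conj_transpose_def matrix_matrix_mult_def mat_def vec_eq_iff herm_prod_def)
  then have unit: "U ** conj_transpose U = mat 1" by (rule matrix_left_right_inverse_herm)
  have "X ** U = U ** real_diag d"
    using eig by (simp add: vec_eq_iff mult_real_diag_component)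
      (simp add: U_def matrix_matrix_mult_def matrix_vector_mult_def)
  then have "X = U ** real_diag d ** conj_transpose U"
    by (metis matrix_mul_assoc matrix_mul_rid unit)
  with unit show thesis by (rule that)
qed

lemma matrix_add_rdistrib:
  fixes A B :: "'a::semiring_1^'n^'m"
  shows "(A + B) ** C = A ** C + B ** C"
  by (simp add: matrix_matrix_mult_def vec_eq_iff distrib_right sum.distrib)

section \<open>Positive definite matrices and their powers\<close>

lemma pos_def_iff:
  "X \<in> pos_def \<longleftrightarrow> X = conj_transpose X \<and> (\<forall>v. v \<noteq> 0 \<longrightarrow> (\<exists>r>0. herm_prod v (X *v v) = of_real r))"
  by (simp add: pos_def_def herm_prod_def)

lemma pos_def_congruence:
  assumes "X \<in> pos_def" and inv: "T ** S = mat 1"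
  shows "conj_transpose S ** X ** S \<in> pos_def"
  unfolding pos_def_iff
proof (intro conjI allI impI)
  show "conj_transpose S ** X ** S = conj_transpose (conj_transpose S ** X ** S)"
    using assms(1) by (simp add: pos_def_iff conj_transpose_mult matrix_mul_assoc)
  fix v :: "'a^'b" assume "v \<noteq> 0"
  moreover have "T *v (S *v v) = v" by (simp add: matrix_vector_mul_assoc inv)
  ultimately have "S *v v \<noteq> 0" by auto
  then have "\<exists>r>0. herm_prod (S *v v) (X *v (S *v v)) = of_real r"
    using assms(1) by (simp add: pos_def_iff)
  then show "\<exists>r>0. herm_prod v ((conj_transpose S ** X ** S) *v v) = of_real r"
    using herm_prod_adjoint[of "conj_transpose S" v]
    by (simp add: matrix_vector_mul_assoc[symmetric])
qed

lemma herm_prod_axis: "herm_prod (axis i 1) (M *v axis i 1) = M $ i $ i"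
proof -
  have "(M *v axis i 1) $ j = M $ j $ i" for j
    by (simp add: matrix_vector_mult_def axis_def if_distrib[of "(*) _"] cong: if_cong)
  then show ?thesis
    by (simp add: herm_prod_def axis_def if_distrib[of star_conj] if_distrib[of "\<lambda>x. x * _"] cong: if_cong)
qed

text \<open>Evaluate the form at a standard basis vector.\<close>

lemma pos_def_diagonal_entry:
  fixes X :: "'d::star_div_algebra^'n^'n"
  assumes "X \<in> pos_def"
  shows "\<exists>r>0. X $ i $ i = of_real r"
proof -
  have "(axis i 1 :: 'd^'n) \<noteq> 0" by (simp add: axis_eq_0_iff)
  then show ?thesis using assms by (metis herm_prod_axis pos_def_iff)
qed

lemma real_diag_pos_def:
  fixes d :: "'n::finite \<Rightarrow> real"
  assumes "\<And>i. d i > 0"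
  shows "(real_diag d :: 'd::hermitian_div_algebra^'n^'n) \<in> pos_def"
  unfolding pos_def_iff
proof (intro conjI allI impI)
  fix v :: "'d^'n" assume v: "v \<noteq> 0"
  then obtain k where k: "v $ k \<noteq> 0" by (auto simp: vec_eq_iff)
  have sq: "star_conj x * x = of_real (inner x x)" for x :: 'd
  proof -
    have "2 *\<^sub>R (star_conj x * x) = 2 *\<^sub>R of_real (inner x x)"
      using of_real_inner[of x x] by (simp only: mult_2 of_real_add scaleR_2)
    then show ?thesis by simp
  qed
  have "herm_prod v (real_diag d *v v) = of_real (\<Sum>i\<in>UNIV. d i * inner (v $ i) (v $ i))"
    by (simp add: herm_prod_def real_diag_vector sq) (simp add: scaleR_conv_of_real)
  moreover have "(\<Sum>i\<in>UNIV. d i * inner (v $ i) (v $ i)) > 0"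
    by (rule sum_pos2[of _ k])
      (simp_all add: assms k mult_nonneg_nonneg less_imp_le[OF assms])
  ultimately show "\<exists>r>0. herm_prod v (real_diag d *v v) = of_real r" by blast
qed simp

lemma pos_def_spectral_decomposition:
  fixes X :: "'d::hermitian_div_algebra^'n^'n"
  assumes "X \<in> pos_def"
  obtains U d where "U ** conj_transpose U = mat 1" "\<forall>i. d i > 0"
    "X = U ** real_diag d ** conj_transpose U"
proof -
  have "X = conj_transpose X" using assms by (simp add: pos_def_iff)
  then obtain U d where U: "U ** conj_transpose U = mat 1"
    and X: "X = U ** real_diag d ** conj_transpose U"
    by (rule spectral_decomposition)
  have U': "conj_transpose U ** U = mat 1" using U by (rule matrix_left_right_inverse_herm)
  have "conj_transpose U ** X ** U = (conj_transpose U ** U) ** real_diag d ** (conj_transpose U ** U)"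
    unfolding X by (simp only: matrix_mul_assoc)
  then have "real_diag d = conj_transpose U ** X ** U" by (simp add: U')
  then have "real_diag d \<in> (pos_def :: ('d^'n^'n) set)"
    using pos_def_congruence[OF assms U'] by simp
  then have "d i > 0" for i
    using pos_def_diagonal_entry[of "real_diag d :: 'd^'n^'n" i] by (auto simp: real_diag_def)
  then show thesis using that[OF U _ X] by blast
qed

text \<open>The matrix \<open>W = V\<^sup>* U\<close> intertwines the two diagonal matrices. Entrywise, \<open>W\<^sub>i\<^sub>j\<close> can be nonzero only
  if \<open>d\<^sub>j = e\<^sub>i\<close>, and then \<open>f (d\<^sub>j) = f (e\<^sub>i)\<close>, so \<open>W\<close> intertwines the images under \<open>f\<close> as well. Real scalars
  are central, so the order of multiplication is harmless.\<close>

lemma spectral_calculus_unique: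
  fixes U V :: "'d::hermitian_div_algebra^'n^'n"
  assumes U: "U ** conj_transpose U = mat 1" and V: "V ** conj_transpose V = mat 1"
    and eq: "U ** real_diag d ** conj_transpose U = V ** real_diag e ** conj_transpose V"
  shows "U ** real_diag (\<lambda>i. f (d i)) ** conj_transpose U
       = V ** real_diag (\<lambda>i. f (e i)) ** conj_transpose V"
proof -
  have U': "conj_transpose U ** U = mat 1" and V': "conj_transpose V ** V = mat 1"
    using U V by (auto intro: matrix_left_right_inverse_herm)
  define W where "W = conj_transpose V ** U"
  have "W ** real_diag d = conj_transpose V ** (U ** real_diag d ** conj_transpose U) ** U"
    unfolding W_def by (simp add: matrix_mul_assoc[symmetric] U')
  also have "\<dots> = real_diag e ** W"
    unfolding W_def eq by (simp add: matrix_mul_assoc V')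
  finally have "W ** real_diag d = real_diag e ** W" .
  then have "d j *\<^sub>R W $ i $ j = e i *\<^sub>R W $ i $ j" for i j
    by (metis mult_real_diag_component real_diag_mult_component)
  then have "f (d j) *\<^sub>R W $ i $ j = f (e i) *\<^sub>R W $ i $ j" for i j
    by (metis scaleR_cancel_right)
  then have W: "W ** real_diag (\<lambda>i. f (d i)) = real_diag (\<lambda>i. f (e i)) ** W"
    by (simp add: vec_eq_iff mult_real_diag_component real_diag_mult_component)
  have "U ** real_diag (\<lambda>i. f (d i)) ** conj_transpose U
      = V ** (W ** real_diag (\<lambda>i. f (d i))) ** conj_transpose U"
    unfolding W_def by (simp add: matrix_mul_assoc V)
  also have "\<dots> = V ** real_diag (\<lambda>i. f (e i)) ** conj_transpose V"
    unfolding W unfolding W_def by (simp add: matrix_mul_assoc[symmetric] U)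
  finally show ?thesis .
qed

lemma mat_powr_eq:
  fixes U :: "'d::hermitian_div_algebra^'n^'n"
  assumes U: "U ** conj_transpose U = mat 1" and d: "\<And>i. d i > 0"
    and X: "X = U ** real_diag d ** conj_transpose U"
  shows "mat_powr X t = U ** real_diag (\<lambda>i. d i powr t) ** conj_transpose U"
  unfolding mat_powr_def
proof (rule the_equality)
  show "\<exists>U' d'. U' ** conj_transpose U' = mat 1 \<and> (\<forall>i. d' i > 0) \<and>
      X = U' ** real_diag d' ** conj_transpose U' \<and>
      U ** real_diag (\<lambda>i. d i powr t) ** conj_transpose U
        = U' ** real_diag (\<lambda>i. d' i powr t) ** conj_transpose U'"
    using U d X by blast
next
  fix Y
  assume "\<exists>V e. V ** conj_transpose V = mat 1 \<and> (\<forall>i. e i > 0) \<and>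
      X = V ** real_diag e ** conj_transpose V \<and>
      Y = V ** real_diag (\<lambda>i. e i powr t) ** conj_transpose V"
  then obtain V e where V: "V ** conj_transpose V = mat 1"
    and eq: "V ** real_diag e ** conj_transpose V = U ** real_diag d ** conj_transpose U"
    and Y: "Y = V ** real_diag (\<lambda>i. e i powr t) ** conj_transpose V"
    using X by metis
  show "Y = U ** real_diag (\<lambda>i. d i powr t) ** conj_transpose U"
    unfolding Y by (rule spectral_calculus_unique[OF V U eq, of "\<lambda>x. x powr t"])
qed

lemma mat_powr_properties:
  fixes X :: "'d::hermitian_div_algebra^'n^'n"
  assumes "X \<in> pos_def"
  shows mat_powr_pos_def: "mat_powr X t \<in> pos_def"
    and mat_powr_add: "mat_powr X s ** mat_powr X t = mat_powr X (s + t)"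
    and mat_powr_zero: "mat_powr X 0 = mat 1"
    and mat_powr_one: "mat_powr X 1 = X"
proof -
  obtain U d where U: "U ** conj_transpose U = mat 1" and "\<forall>i. d i > 0"
    and X: "X = U ** real_diag d ** conj_transpose U"
    using assms by (rule pos_def_spectral_decomposition)
  then have d: "d i > 0" for i by blast
  note pow = mat_powr_eq[OF U d X]
  have U': "conj_transpose U ** U = mat 1" using U by (rule matrix_left_right_inverse_herm)
  have d': "d i \<noteq> 0" for i using d[of i] by simp
  have "real_diag (\<lambda>i. d i powr t) \<in> (pos_def :: ('d^'n^'n) set)"
    using d' by (intro real_diag_pos_def) simp
  from pos_def_congruence[OF this, of U "conj_transpose U"] show "mat_powr X t \<in> pos_def"
    by (simp add: pow U)
  have "mat_powr X s ** mat_powr X t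
      = U ** real_diag (\<lambda>i. d i powr s) ** (conj_transpose U ** U) ** real_diag (\<lambda>i. d i powr t) ** conj_transpose U"
    unfolding pow by (simp only: matrix_mul_assoc)
  also have "\<dots> = U ** (real_diag (\<lambda>i. d i powr s) ** real_diag (\<lambda>i. d i powr t)) ** conj_transpose U"
    by (simp add: U' matrix_mul_assoc)
  also have "\<dots> = mat_powr X (s + t)"
    by (simp add: real_diag_mult pow powr_add)
  finally show "mat_powr X s ** mat_powr X t = mat_powr X (s + t)" .
  show "mat_powr X 0 = mat 1" by (simp add: pow d' real_diag_one U)
  have "d i powr 1 = d i" for i using d[of i] by simp
  then show "mat_powr X 1 = X" unfolding pow using X by simp
qed

lemma conj_transpose_pos_def: "X \<in> pos_def \<Longrightarrow> conj_transpose X = X"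
  by (simp add: pos_def_iff)

lemma matrix_inv_eq_mat_powr:
  fixes X :: "'d::hermitian_div_algebra^'n^'n"
  assumes "X \<in> pos_def"
  shows "matrix_inv X = mat_powr X (-1)"
proof -
  have 1: "X ** mat_powr X (-1) = mat 1" "mat_powr X (-1) ** X = mat 1"
    using mat_powr_add[OF assms, of 1 "-1"] mat_powr_add[OF assms, of "-1" 1]
    by (simp_all add: mat_powr_one[OF assms] mat_powr_zero[OF assms])
  have "X ** matrix_inv X = mat 1 \<and> matrix_inv X ** X = mat 1"
    unfolding matrix_inv_def by (rule someI_ex) (use 1 in blast)
  then have "matrix_inv X = matrix_inv X ** (X ** mat_powr X (-1))" by (simp add: 1)
  also have "\<dots> = mat_powr X (-1)"
    using \<open>X ** matrix_inv X = mat 1 \<and> matrix_inv X ** X = mat 1\<close> by (simp add: matrix_mul_assoc)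
  finally show ?thesis .
qed

section \<open>The Riccati equation and the theorem\<close>

text \<open>With \<open>R = C\<^sup>1\<^sup>/\<^sup>2\<close>, \<open>Q = R\<^sup>-\<^sup>1\<close> and \<open>G = (Q B Q)\<^sup>1\<^sup>/\<^sup>2\<close> the mean is \<open>R G R\<close>, a congruence of \<open>G\<close>. In the
  Riccati product the inner factors \<open>R C\<^sup>-\<^sup>1 R\<close> cancel and leave \<open>R G\<^sup>2 R = B\<close>.\<close>

lemma
  fixes C B :: "'d::hermitian_div_algebra^'n^'n"
  assumes C: "C \<in> pos_def" and B: "B \<in> pos_def"
  shows geometric_mean_pos_def: "C \<sharp> B \<in> pos_def"
    and geometric_mean_riccati: "(C \<sharp> B) ** matrix_inv C ** (C \<sharp> B) = B"
proof -
  define R where "R = mat_powr C (1/2)"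
  define Q where "Q = mat_powr C (-1/2)"
  define M where "M = Q ** B ** Q"
  define G where "G = mat_powr M (1/2)"
  have RQ: "R ** Q = mat 1" "Q ** R = mat 1"
    unfolding R_def Q_def by (simp_all add: mat_powr_add[OF C] mat_powr_zero[OF C])
  have star: "conj_transpose R = R" "conj_transpose Q = Q"
    unfolding R_def Q_def by (simp_all add: conj_transpose_pos_def mat_powr_pos_def[OF C])
  have M: "M \<in> pos_def"
    using pos_def_congruence[OF B RQ(1)] by (simp add: M_def star)
  have G: "G \<in> pos_def" and GG: "G ** G = M"
    unfolding G_def by (simp_all add: mat_powr_pos_def[OF M] mat_powr_add[OF M] mat_powr_one[OF M])
  have mean: "C \<sharp> B = R ** G ** R"
    by (simp add: geometric_mean_def R_def G_def M_def Q_def)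
  show "C \<sharp> B \<in> pos_def"
    unfolding mean using pos_def_congruence[OF G RQ(2)] by (simp add: star)
  have "matrix_inv C = Q ** Q"
    by (simp add: matrix_inv_eq_mat_powr[OF C] Q_def mat_powr_add[OF C])
  then have "(C \<sharp> B) ** matrix_inv C ** (C \<sharp> B) = R ** G ** (R ** Q) ** (Q ** R) ** G ** R"
    unfolding mean by (simp only: matrix_mul_assoc)
  also have "\<dots> = R ** (G ** G) ** R" by (simp add: RQ matrix_mul_assoc)
  also have "\<dots> = (R ** Q) ** B ** (Q ** R)" by (simp only: GG M_def matrix_mul_assoc)
  also have "\<dots> = B" by (simp add: RQ)
  finally show "(C \<sharp> B) ** matrix_inv C ** (C \<sharp> B) = B" .
qed

text \<open>In the eigenbasis the equation of a right eigenvector is \<open>w\<^sub>i h\<^sub>i = w\<^sub>i l\<close>, where \<open>h\<^sub>i\<close> moves to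
  the right because it is real. Cancelling a nonzero \<open>w\<^sub>i\<close> excludes nonreal conjugates, which
  would otherwise make the quaternionic spectrum infinite.\<close>

lemma Spec_real_diag_conjugate:
  fixes U :: "'d::hermitian_div_algebra^'n^'n"
  assumes U: "U ** conj_transpose U = mat 1"
  shows "Spec (U ** real_diag h ** conj_transpose U) \<subseteq> of_real ` range h"
proof
  fix l assume "l \<in> Spec (U ** real_diag h ** conj_transpose U)"
  then obtain v where v: "v \<noteq> 0"
    and eig: "(U ** real_diag h ** conj_transpose U) *v v = (\<chi> i. v $ i * l)"
    by (auto simp: Spec_def)
  have U': "conj_transpose U ** U = mat 1" using U by (rule matrix_left_right_inverse_herm)
  define w where "w = conj_transpose U *v v"
  have "U *v w = v" by (simp add: w_def matrix_vector_mul_assoc U)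
  then have "w \<noteq> 0" using v by auto
  then obtain i where i: "w $ i \<noteq> 0" by (auto simp: vec_eq_iff)
  have "real_diag h *v w = conj_transpose U *v ((U ** real_diag h ** conj_transpose U) *v v)"
    by (simp add: w_def matrix_vector_mul_assoc matrix_mul_assoc U')
  also have "\<dots> $ i = w $ i * l"
    unfolding eig w_def by (simp add: matrix_vector_mult_def sum_distrib_right mult.assoc)
  finally have "w $ i * of_real (h i) = w $ i * l"
    by (simp add: real_diag_vector of_real_def)
  then have "l = of_real (h i)" using i by simp
  then show "l \<in> of_real ` range h" by blast
qed

lemma real_quadratic_roots:
  fixes p q :: real
  defines "Z \<equiv> {x. 2 * x = p + q * x\<^sup>2}"
  shows "finite Z" "card Z \<le> 2"
proof -
  have Z: "Z = {x. poly [:p, -2, q:] x = 0}"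
    by (auto simp: Z_def power2_eq_square algebra_simps)
  have ne: "[:p, -2, q:] \<noteq> 0" by simp
  show "finite Z" unfolding Z by (rule poly_roots_finite[OF ne])
  have "card Z \<le> degree [:p, -2, q:]" unfolding Z by (rule card_poly_roots_bound[OF ne])
  also have "\<dots> \<le> 2" by (simp add: degree_pCons_eq_if)
  finally show "card Z \<le> 2" .
qed

text \<open>Adding the first two equations and subtracting twice the third leaves \<open>q (x - y)\<^sup>2 = 0\<close>. If
  \<open>q = 0\<close>, the equations are linear with the common solution \<open>p / 2\<close>.\<close>

lemma quadratic_roots_eq_if_polarized:
  fixes p q x y :: real
  assumes x: "2 * x = p + q * x\<^sup>2" and y: "2 * y = p + q * y\<^sup>2" and xy: "x + y = p + q * (x * y)"
  shows "x = y"
proof -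
  have "q * (x - y)\<^sup>2 = q * x\<^sup>2 + q * y\<^sup>2 - 2 * (q * (x * y))"
    by (simp add: power2_eq_square algebra_simps)
  also have "\<dots> = 0" using x y xy by linarith
  finally have "q * (x - y)\<^sup>2 = 0" .
  then show ?thesis using x y by auto
qed

theorem wasserstein_linearizable_commute:
  fixes A B :: "'d::hermitian_div_algebra^'n^'n"
  assumes A: "A \<in> pos_def" and B: "B \<in> pos_def" and lin: "wasserstein_linearizable A B"
  shows "finite (Spec (matrix_inv A \<sharp> B)) \<and> card (Spec (matrix_inv A \<sharp> B)) \<le> 2 \<and> A ** B = B ** A"
proof -
  define C where "C = matrix_inv A"
  have Cp: "C = mat_powr A (-1)" unfolding C_def using A by (rule matrix_inv_eq_mat_powr)
  have C: "C \<in> pos_def" unfolding Cp using A by (rule mat_powr_pos_def)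
  have AC: "A ** C = mat 1"
    using mat_powr_add[OF A, of 1 "-1"] by (simp add: Cp mat_powr_one[OF A] mat_powr_zero[OF A])
  have "matrix_inv C = A"
  proof -
    have "C ** matrix_inv C = mat 1"
      using mat_powr_add[OF C, of 1 "-1"]
      by (simp add: matrix_inv_eq_mat_powr[OF C] mat_powr_one[OF C] mat_powr_zero[OF C])
    then show ?thesis by (metis AC matrix_mul_assoc matrix_mul_lid matrix_mul_rid)
  qed
  define H where "H = matrix_inv A \<sharp> B"
  have H: "H \<in> pos_def" and HAH: "H ** A ** H = B"
    using geometric_mean_pos_def[OF C B] geometric_mean_riccati[OF C B]
    by (simp_all add: H_def C_def[symmetric] \<open>matrix_inv C = A\<close>)
  obtain a b where ab: "(1/4) *\<^sub>R ((mat 1 + H) ** A ** (mat 1 + H)) = a *\<^sub>R A + b *\<^sub>R B"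
    using lin by (auto simp: wasserstein_linearizable_def wasserstein_mean_def H_def)
  \<comment> \<open>The coefficients left after moving \<open>A\<close> and \<open>B\<close> from the expanded mean to the right-hand side.\<close>
  define p q where "p = 4 * a - 1" and "q = 4 * b - 1"
  have "(mat 1 + H) ** A ** (mat 1 + H) = 4 *\<^sub>R (a *\<^sub>R A + b *\<^sub>R B)"
    by (simp flip: ab)
  then have "A + H ** A + A ** H + B = 4 *\<^sub>R (a *\<^sub>R A + b *\<^sub>R B)"
    by (simp add: matrix_add_ldistrib matrix_add_rdistrib HAH add_ac)
  then have key: "H ** A + A ** H = p *\<^sub>R A + q *\<^sub>R (H ** A ** H)"
    by (simp add: p_def q_def HAH algebra_simps)
  obtain U h where U: "U ** conj_transpose U = mat 1"
    and HU: "H = U ** real_diag h ** conj_transpose U"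
    using H by (rule pos_def_spectral_decomposition)
  have U': "conj_transpose U ** U = mat 1" using U by (rule matrix_left_right_inverse_herm)
  \<comment> \<open>The matrix of \<open>A\<close> in the eigenbasis of \<open>H\<close>.\<close>
  define N where "N = conj_transpose U ** A ** U"
  have N: "N \<in> pos_def" unfolding N_def using A U' by (rule pos_def_congruence)
  have AN: "A = U ** N ** conj_transpose U"
    by (simp add: N_def matrix_mul_assoc U) (simp add: matrix_mul_assoc[symmetric] U)
  have cancel: "conj_transpose U ** (U ** Y) = Y" for Y :: "'d^'n^'n"
    by (simp add: matrix_mul_assoc U')
  let ?D = "real_diag h"
  have "conj_transpose U ** (H ** A + A ** H) ** U = ?D ** N + N ** ?D"
    unfolding HU AN
    by (simp add: matrix_add_ldistrib matrix_add_rdistrib matrix_mul_assoc[symmetric] cancel U')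
  moreover have "conj_transpose U ** (p *\<^sub>R A + q *\<^sub>R (H ** A ** H)) ** U
      = p *\<^sub>R N + q *\<^sub>R (?D ** N ** ?D)"
    unfolding HU AN
    by (simp add: matrix_add_ldistrib matrix_add_rdistrib matrix_scalar_ac
        scalar_matrix_assoc[symmetric] matrix_mul_assoc[symmetric] cancel U')
  ultimately have diag: "?D ** N + N ** ?D = p *\<^sub>R N + q *\<^sub>R (?D ** N ** ?D)"
    using key by simp
  have entry: "(h i + h j) *\<^sub>R N $ i $ j = (p + q * (h i * h j)) *\<^sub>R N $ i $ j" for i j
  proof -
    have "(?D ** N + N ** ?D) $ i $ j = (p *\<^sub>R N + q *\<^sub>R (?D ** N ** ?D)) $ i $ j"
      by (simp only: diag)
    then show ?thesis
      by (simp add: real_diag_mult_component mult_real_diag_component scaleR_add_left mult_ac)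
  qed
  have rel: "h i + h j = p + q * (h i * h j)" if "N $ i $ j \<noteq> 0" for i j
    using entry[of i j] that by simp
  have quad: "2 * h i = p + q * (h i)\<^sup>2" for i
  proof -
    have "N $ i $ i \<noteq> 0" using pos_def_diagonal_entry[OF N, of i] by auto
    from rel[OF this] show ?thesis by (simp add: power2_eq_square)
  qed
  have "h i *\<^sub>R N $ i $ j = h j *\<^sub>R N $ i $ j" for i j
    using quadratic_roots_eq_if_polarized[OF quad quad rel, of i j] by (cases "N $ i $ j = 0") auto
  then have "?D ** N = N ** ?D"
    by (simp add: vec_eq_iff real_diag_mult_component mult_real_diag_component)
  then have "U ** (?D ** N) ** conj_transpose U = U ** (N ** ?D) ** conj_transpose U" by simp
  moreover have "U ** (?D ** N) ** conj_transpose U = H ** A"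
    unfolding HU AN by (simp add: matrix_mul_assoc[symmetric] cancel)
  moreover have "U ** (N ** ?D) ** conj_transpose U = A ** H"
    unfolding HU AN by (simp add: matrix_mul_assoc[symmetric] cancel)
  ultimately have comm: "H ** A = A ** H" by simp
  have "A ** B = (A ** H) ** A ** H" by (simp add: HAH[symmetric] matrix_mul_assoc)
  also have "\<dots> = H ** A ** (H ** A)" by (simp only: comm matrix_mul_assoc)
  also have "\<dots> = B ** A" by (simp add: HAH[symmetric] matrix_mul_assoc)
  finally have AB: "A ** B = B ** A" .
  let ?Z = "{x. 2 * x = p + q * x\<^sup>2}"
  have fin: "finite ?Z" and card: "card ?Z \<le> 2" by (fact real_quadratic_roots)+
  have sub: "Spec H \<subseteq> of_real ` ?Z"
    using Spec_real_diag_conjugate[OF U, of h] quad unfolding HU by blast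
  then have "finite (Spec H)" using fin by (meson finite_imageI finite_subset)
  moreover have "card (Spec H) \<le> card ?Z"
    using sub fin by (rule surj_card_le[rotated])
  ultimately show ?thesis using card AB by (auto simp: H_def)
qed

theorem theorem3p1:
  shows "(\<forall>A B :: real^'n^'n. A \<in> pos_def \<longrightarrow> B \<in> pos_def \<longrightarrow> wasserstein_linearizable A B \<longrightarrow>
            finite (Spec (matrix_inv A \<sharp> B)) \<and> card (Spec (matrix_inv A \<sharp> B)) \<le> 2 \<and>
            A ** B = B ** A) \<and>
         (\<forall>A B :: complex^'n^'n. A \<in> pos_def \<longrightarrow> B \<in> pos_def \<longrightarrow> wasserstein_linearizable A B \<longrightarrow>
            finite (Spec (matrix_inv A \<sharp> B)) \<and> card (Spec (matrix_inv A \<sharp> B)) \<le> 2 \<and>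
            A ** B = B ** A) \<and>
         (\<forall>A B :: quat^'n^'n. A \<in> pos_def \<longrightarrow> B \<in> pos_def \<longrightarrow> wasserstein_linearizable A B \<longrightarrow>
            finite (Spec (matrix_inv A \<sharp> B)) \<and> card (Spec (matrix_inv A \<sharp> B)) \<le> 2 \<and>
            A ** B = B ** A)"
  by (intro conjI allI impI; use wasserstein_linearizable_commute in blast)

end
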